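(* Let $\mathcal{H}$ be a complex Hilbert space and let $A,B\in\mathcal{B}(\mathcal{H})$. If $f:[0,\infty)\to[0,\infty)$ is an increasing operator convex function, then \[\left\| f\left( \frac{|A|+|B|}{4} \right) \right\|\le \left\| \int_{0}^{1} f\left( \frac{(1-t)|A|+t|B|}{2} \right)dt \right\|\le \frac{1}{2}f\left( \frac{1}{2}\|A\| \right)+\frac{1}{2}f\left( \frac{1}{2}\|B\| \right).\]
   Context: $\mathcal{B}(\mathcal{H})$ is the $C^*$-algebra of bounded linear operators on the complex Hilbert space $\mathcal{H}$; $\|\cdot\|$ is the operator norm; $|A|=(A^*A)^{1/2}$. A function $f:J\to\mathbb{R}$ on an interval $J$ is operator convex if it is continuous and $f\left(\frac{X+Y}{2}\right)\le\frac{f(X)+f(Y)}{2}$ (in the positive semi-definite order) for all self adjoint operators $X,Y$ with spectra in $J$. For $X$ self adjoint with spectrum in $J$, $f(X)$ is defined by functional calculus. *)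

theory Defs
  imports "HOL-Analysis.Analysis" "HOL-Computational_Algebra.Polynomial"
begin

text \<open>Complex Hilbert spaces: Banach spaces with a compatible complex scalar multiplication, whose
  norm is induced by a complex inner product (linear in the first argument).\<close>

class complex_hilbert = banach +
  fixes scaleC :: "complex \<Rightarrow> 'a \<Rightarrow> 'a"  (infixr \<open>*\<^sub>C\<close> 75)
    and cinner :: "'a \<Rightarrow> 'a \<Rightarrow> complex"
  assumes scaleC_add_right: "c *\<^sub>C (x + y) = c *\<^sub>C x + c *\<^sub>C y"
    and scaleC_add_left: "(c + d) *\<^sub>C x = c *\<^sub>C x + d *\<^sub>C x"
    and scaleC_scaleC: "c *\<^sub>C d *\<^sub>C x = (c * d) *\<^sub>C x"
    and scaleR_scaleC: "r *\<^sub>R x = complex_of_real r *\<^sub>C x"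
    and cinner_add_left: "cinner (x + y) z = cinner x z + cinner y z"
    and cinner_scaleC_left: "cinner (c *\<^sub>C x) y = c * cinner x y"
    and cinner_commute: "cinner x y = cnj (cinner y x)"
    and cinner_self: "cinner x x = complex_of_real ((norm x)\<^sup>2)"

instantiation complex :: complex_hilbert
begin

definition scaleC_complex :: "complex \<Rightarrow> complex \<Rightarrow> complex"
  where "scaleC_complex c x = c * x"

definition cinner_complex :: "complex \<Rightarrow> complex \<Rightarrow> complex"
  where "cinner_complex x y = x * cnj y"

instance
  by standard
    (simp_all only: scaleC_complex_def cinner_complex_def complex_norm_square scaleR_conv_of_real
      algebra_simps complex_cnj_mult complex_cnj_cnj)

end

text \<open>The type \<open>'a \<Rightarrow>\<^sub>L 'a\<close> consists of the bounded real-linear operators, normed by the operator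
  norm.  The algebra of bounded operators of the complex Hilbert space \<open>'a\<close> is the norm-closed
  subspace of those satisfying the following predicate.\<close>

definition complex_linear :: "('a::complex_hilbert \<Rightarrow>\<^sub>L 'a) \<Rightarrow> bool"
  where "complex_linear A \<longleftrightarrow> (\<forall>c x. A (c *\<^sub>C x) = c *\<^sub>C A x)"

definition hadjoint :: "('a::complex_hilbert \<Rightarrow>\<^sub>L 'a) \<Rightarrow> ('a \<Rightarrow>\<^sub>L 'a)"
  where "hadjoint A = (THE B :: 'a \<Rightarrow>\<^sub>L 'a. \<forall>x y. cinner (A x) y = cinner x (B y))"

definition self_adjoint :: "('a::complex_hilbert \<Rightarrow>\<^sub>L 'a) \<Rightarrow> bool"
  where "self_adjoint A \<longleftrightarrow> complex_linear A \<and> hadjoint A = A"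

definition positive_op :: "('a::complex_hilbert \<Rightarrow>\<^sub>L 'a) \<Rightarrow> bool"
  where "positive_op A \<longleftrightarrow> self_adjoint A \<and> (\<forall>x. 0 \<le> Re (cinner (A x) x))"

definition op_le :: "('a::complex_hilbert \<Rightarrow>\<^sub>L 'a) \<Rightarrow> ('a \<Rightarrow>\<^sub>L 'a) \<Rightarrow> bool"
  where "op_le A B \<longleftrightarrow> positive_op (B - A)"

definition op_spectrum :: "('a::complex_hilbert \<Rightarrow>\<^sub>L 'a) \<Rightarrow> complex set"
  where "op_spectrum A =
    {z. \<not> (\<exists>C :: 'a \<Rightarrow>\<^sub>L 'a. complex_linear C \<and>
        (\<forall>x. C (z *\<^sub>C x - A x) = x) \<and> (\<forall>x. z *\<^sub>C C x - A (C x) = x))}"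

definition op_poly :: "real poly \<Rightarrow> ('a::complex_hilbert \<Rightarrow>\<^sub>L 'a) \<Rightarrow> ('a \<Rightarrow>\<^sub>L 'a)"
  where "op_poly p X = (\<Sum>i\<le>degree p. coeff p i *\<^sub>R (((o\<^sub>L) X ^^ i) id_blinfun))"

text \<open>Continuous functional calculus, for \<open>X\<close> self-adjoint and \<open>f\<close> real-valued and continuous on
  the (real) spectrum of \<open>X\<close>: \<open>f(X)\<close> is the norm limit of \<open>p\<^sub>n(X)\<close> for any real
  polynomials \<open>p\<^sub>n\<close> converging to \<open>f\<close> uniformly on the spectrum.  Such polynomials exist by the
  Weierstrass theorem, and the limit does not depend on their choice.\<close>

definition fun_calc :: "(real \<Rightarrow> real) \<Rightarrow> ('a::complex_hilbert \<Rightarrow>\<^sub>L 'a) \<Rightarrow> ('a \<Rightarrow>\<^sub>L 'a)"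
  where "fun_calc f X = (THE Y :: 'a \<Rightarrow>\<^sub>L 'a. \<exists>p :: nat \<Rightarrow> real poly.
      uniform_limit {r. complex_of_real r \<in> op_spectrum X} (\<lambda>n. poly (p n)) f sequentially \<and>
      (\<lambda>n. op_poly (p n) X) \<longlonglongrightarrow> Y)"

definition op_abs :: "('a::complex_hilbert \<Rightarrow>\<^sub>L 'a) \<Rightarrow> ('a \<Rightarrow>\<^sub>L 'a)"
  where "op_abs A = fun_calc sqrt (hadjoint A o\<^sub>L A)"

text \<open>Operator convexity on the interval \<open>J\<close>, with respect to the operators on the Hilbert space
  \<open>'a\<close>.  A function that is operator convex on every Hilbert space is so in particular on \<open>'a\<close>.\<close>

definition operator_convex_on :: "'a::complex_hilbert itself \<Rightarrow> real set \<Rightarrow> (real \<Rightarrow> real) \<Rightarrow> bool"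
  where "operator_convex_on (_ :: 'a itself) J f \<longleftrightarrow>
    continuous_on J f \<and>
    (\<forall>X Y :: 'a \<Rightarrow>\<^sub>L 'a.
      self_adjoint X \<longrightarrow> self_adjoint Y \<longrightarrow>
      op_spectrum X \<subseteq> complex_of_real ` J \<longrightarrow> op_spectrum Y \<subseteq> complex_of_real ` J \<longrightarrow>
      op_le (fun_calc f ((1/2) *\<^sub>R (X + Y))) ((1/2) *\<^sub>R (fun_calc f X + fun_calc f Y)))"

end

theory Submission
  imports Defs "HOL-Computational_Algebra.Fundamental_Theorem_Algebra"
begin

text \<open>Put \<open>X t = ((1 - t)|A| + t|B|) / 2\<close>, a segment of positive operators, and \<open>G t = f (X t)\<close>.
  Operator convexity of \<open>f\<close> says that \<open>t \<mapsto> G t\<close> is midpoint convex in the operator order, and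
  both inequalities are Hermite-Hadamard inequalities for real functions derived from \<open>G\<close>.

  For the left one, each quadratic form \<open>t \<mapsto> \<langle>G t x, x\<rangle>\<close> is continuous and midpoint convex, so its
  value at \<open>1/2\<close> is at most its mean, which is the quadratic form of the integral of \<open>G\<close>
  (\<open>midpoint_convex_le_integral\<close>).  Since \<open>G (1/2)\<close> is positive, a bound on its
  quadratic form over unit vectors is a bound on its norm (\<open>norm_positive_op_le\<close>).

  For the right one, the norm is monotone on positive operators, so \<open>t \<mapsto> norm (G t)\<close> is itself a
  continuous midpoint convex function and lies below its chord (\<open>midpoint_convex_le_chord\<close>).
  Integrating the chord gives the mean of \<open>norm (f (|A|/2))\<close> and \<open>norm (f (|B|/2))\<close>, and these are
  at most \<open>f (norm A / 2)\<close> and \<open>f (norm B / 2)\<close> because \<open>f\<close> is increasing and nonnegative on a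
  spectrum contained in \<open>{0..norm A / 2}\<close>, respectively \<open>{0..norm B / 2}\<close>.

  What remains is the functional calculus.  Its foundation is the estimate
  \<open>norm (p(X)) \<le> sup |p|\<close> over the spectrum of a self-adjoint \<open>X\<close>, for real polynomials \<open>p\<close>
  (\<open>norm_op_poly_le\<close>).  With \<open>N = norm (p(X))\<close>, the operator \<open>p(X)\<^sup>2 - N\<^sup>2\<close> is not bounded below.
  Splitting the polynomial \<open>p\<^sup>2 - N\<^sup>2\<close> into real linear and quadratic factors shows that one of the
  linear factors is not bounded below either, which puts a root, a point with \<open>|p| = N\<close>, in the
  spectrum.  Together with Weierstrass approximation this gives existence, uniqueness, norm bounds,
  positivity and continuity in \<open>X\<close> of \<open>f(X)\<close>.  The other ingredient is that the spectrum lies in any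
  interval that contains the numerical range (\<open>spectrum_subset_interval\<close>): outside of it, \<open>z - X\<close>
  is coercive up to a scalar factor, hence invertible by the contraction principle.\<close>

section \<open>The real inner product and adjoints\<close>

definition rinner :: "'a::complex_hilbert \<Rightarrow> 'a \<Rightarrow> real"
  where "rinner x y = Re (cinner x y)"

lemma cinner_add_right: "cinner x (y + z) = cinner x y + cinner x z"
  by (metis cinner_add_left cinner_commute complex_cnj_add)

lemma cinner_scaleC_right: "cinner x (c *\<^sub>C y) = cnj c * cinner x y"
  by (metis cinner_commute cinner_scaleC_left complex_cnj_mult)

lemma rinner_commute: "rinner x y = rinner y x"
  by (metis rinner_def cinner_commute complex_cnj(1) Re_complex_of_real cnj.simps(1))

lemma rinner_self: "rinner x x = (norm x)\<^sup>2"
  by (simp add: rinner_def cinner_self)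

lemma rinner_add_left: "rinner (x + y) z = rinner x z + rinner y z"
  by (simp add: rinner_def cinner_add_left)

lemma rinner_add_right: "rinner z (x + y) = rinner z x + rinner z y"
  by (simp add: rinner_def cinner_add_right)

lemma rinner_scaleR_left: "rinner (r *\<^sub>R x) y = r * rinner x y"
  by (simp add: rinner_def scaleR_scaleC cinner_scaleC_left)

lemma rinner_scaleR_right: "rinner y (r *\<^sub>R x) = r * rinner y x"
  by (metis rinner_commute rinner_scaleR_left)

text \<open>Since the norm is already known to satisfy the triangle inequality, Cauchy-Schwarz is that
  inequality, squared.\<close>

lemma rinner_le: "rinner x y \<le> norm x * norm y"
proof -
  have "(norm (x + y))\<^sup>2 \<le> (norm x + norm y)\<^sup>2"
    by (intro power_mono norm_triangle_ineq norm_ge_zero)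
  moreover have "(norm (x + y))\<^sup>2 = (norm x)\<^sup>2 + 2 * rinner x y + (norm y)\<^sup>2"
    unfolding rinner_self[symmetric] rinner_add_left rinner_add_right
    by (simp add: rinner_commute[of y x])
  ultimately show ?thesis by (simp add: power2_sum)
qed

lemma abs_rinner_le: "\<bar>rinner x y\<bar> \<le> norm x * norm y"
  using rinner_le[of x y] rinner_le[of "(-1) *\<^sub>R x" y] unfolding rinner_scaleR_left by simp

interpretation rinner: bounded_bilinear rinner
  by (rule bounded_bilinear.intro)
    (auto simp: rinner_add_left rinner_add_right rinner_scaleR_left rinner_scaleR_right
      intro!: exI[of _ 1] abs_rinner_le)

lemma norm_diff_square: "(norm (x - y))\<^sup>2 = (norm x)\<^sup>2 - 2 * rinner x y + (norm y)\<^sup>2"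
  unfolding rinner_self[symmetric] rinner.diff_left rinner.diff_right
  by (simp add: rinner_commute[of y x])

lemma rinner_ext:
  assumes "\<And>x. rinner x y = rinner x z"
  shows "y = z"
proof -
  have "(norm (y - z))\<^sup>2 = rinner (y - z) y - rinner (y - z) z"
    by (simp add: rinner_self[symmetric] rinner.diff_right)
  thus ?thesis using assms by simp
qed

lemma cinner_eq_rinner: "cinner x y = Complex (rinner x y) (rinner x (\<i> *\<^sub>C y))"
  by (simp add: rinner_def cinner_scaleC_right complex_eq_iff)

text \<open>Riesz representation: the representing vector is the minimiser of the strictly convex
  functional \<open>J x = (norm x)\<^sup>2 / 2 - \<phi> x\<close>, at which the derivative of \<open>J\<close> vanishes.  The
  parallelogram law makes every minimising sequence Cauchy.\<close>

lemma riesz_representation: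
  fixes \<phi> :: "'a::complex_hilbert \<Rightarrow> real"
  assumes "bounded_linear \<phi>"
  shows "\<exists>y. \<forall>x. \<phi> x = rinner x y"
proof -
  interpret \<phi>: bounded_linear \<phi> by fact
  define J where "J x = (norm x)\<^sup>2 / 2 - \<phi> x" for x
  obtain K where K: "\<And>x. \<bar>\<phi> x\<bar> \<le> norm x * K"
    using \<phi>.bounded by auto
  have "- (K\<^sup>2 / 2) \<le> J x" for x
  proof -
    have "0 \<le> (norm x - K)\<^sup>2" by simp
    thus ?thesis using K[of x] unfolding J_def power2_diff by (simp add: abs_le_iff)
  qed
  hence bdd: "bdd_below (range J)" by (auto intro!: bdd_belowI)
  define m where "m = Inf (range J)"
  have m: "m \<le> J x" for x unfolding m_def by (intro cInf_lower bdd) simp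
  have "\<exists>x. J x < m + 1 / real (Suc n)" for n
    using cInf_lessD[of "range J" "m + 1 / real (Suc n)"] by (auto simp: m_def)
  then obtain X where X: "\<And>n. J (X n) < m + 1 / real (Suc n)" by metis
  have parallelogram: "(norm (x - y))\<^sup>2 \<le> 4 * ((J x - m) + (J y - m))" for x y
  proof -
    define w where "w = (1/2) *\<^sub>R (x + y)"
    have "(norm w)\<^sup>2 = ((norm x)\<^sup>2 + 2 * rinner x y + (norm y)\<^sup>2) / 4"
      unfolding w_def rinner_self[symmetric] rinner_add_left rinner_add_right rinner_scaleR_left
        rinner_scaleR_right by (simp add: rinner_commute[of y x] field_simps)
    moreover have "\<phi> w = (\<phi> x + \<phi> y) / 2"
      by (simp add: w_def \<phi>.scaleR \<phi>.add)
    ultimately show ?thesis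
      using m[of w] norm_diff_square[of x y] unfolding J_def by argo
  qed
  have "Cauchy X"
  proof (rule CauchyI)
    fix e :: real assume "0 < e"
    then obtain N where N: "inverse (real (Suc N)) < e\<^sup>2 / 8"
      using reals_Archimedean[of "e\<^sup>2 / 8"] by auto
    have near: "J (X n) - m < e\<^sup>2 / 8" if "N \<le> n" for n
    proof -
      have "1 / real (Suc n) \<le> inverse (real (Suc N))"
        using that by (simp add: field_simps)
      thus ?thesis using X[of n] N by linarith
    qed
    have "norm (X i - X j) < e" if "N \<le> i" "N \<le> j" for i j
    proof (rule power2_less_imp_less)
      show "(norm (X i - X j))\<^sup>2 < e\<^sup>2"
        using parallelogram[of "X i" "X j"] near[OF that(1)] near[OF that(2)] by argo
    qed (use \<open>0 < e\<close> in simp)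
    thus "\<exists>N. \<forall>i\<ge>N. \<forall>j\<ge>N. norm (X i - X j) < e" by blast
  qed
  then obtain y where y: "X \<longlonglongrightarrow> y" by (auto simp: Cauchy_convergent_iff convergent_def)
  have "(\<lambda>n. J (X n)) \<longlonglongrightarrow> J y"
    unfolding J_def by (intro tendsto_intros y \<phi>.tendsto) simp
  moreover have "(\<lambda>n. m + 1 / real (Suc n)) \<longlonglongrightarrow> m + 0"
    by (intro tendsto_intros LIMSEQ_Suc[OF lim_1_over_n])
  ultimately have Jy: "J y \<le> m"
    using X LIMSEQ_le[of _ "J y" _ "m + 0"] by (simp add: less_imp_le)
  have "\<phi> x = rinner x y" for x
  proof (rule ccontr)
    define d where "d = \<phi> x - rinner x y"
    assume "\<phi> x \<noteq> rinner x y"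
    hence d: "d \<noteq> 0" by (simp add: d_def)
    hence nx: "0 < (norm x)\<^sup>2" by (auto simp: d_def \<phi>.zero rinner.zero_left)
    \<comment> \<open>the minimiser of \<open>J (y + t *\<^sub>R x) = J y - t * d + t\<^sup>2 * (norm x)\<^sup>2 / 2\<close> in \<open>t\<close>\<close>
    define t where "t = d / (norm x)\<^sup>2"
    have "(norm (y + t *\<^sub>R x))\<^sup>2 = (norm y)\<^sup>2 + 2 * t * rinner x y + t\<^sup>2 * (norm x)\<^sup>2"
      unfolding rinner_self[symmetric] rinner_add_left rinner_add_right rinner_scaleR_left
        rinner_scaleR_right by (simp add: rinner_commute[of y x] power2_eq_square algebra_simps)
    hence "J (y + t *\<^sub>R x) = J y - t * d + t\<^sup>2 * (norm x)\<^sup>2 / 2"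
      unfolding J_def d_def by (simp add: \<phi>.add \<phi>.scaleR algebra_simps)
    also have "\<dots> = J y - d\<^sup>2 / (2 * (norm x)\<^sup>2)"
      using nx by (simp add: t_def power2_eq_square field_simps)
    also have "\<dots> < J y" using d nx by simp
    finally show False using m[of "y + t *\<^sub>R x"] Jy by simp
  qed
  thus ?thesis by blast
qed

text \<open>The Riesz vector of \<open>x \<mapsto> \<langle>A x, y\<rangle>\<close> gives an adjoint for the real inner product.  This adjoint
  commutes with \<open>\<i>\<close> because \<open>A\<close> does, and so is the adjoint for the complex inner product as well.\<close>

lemma cinner_hadjoint:
  fixes A :: "'a::complex_hilbert \<Rightarrow>\<^sub>L 'a"
  assumes "complex_linear A"
  shows "cinner (A x) y = cinner x (hadjoint A y)"
proof -
  have "\<exists>z. \<forall>x. rinner (A x) y = rinner x z" for y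
    by (rule riesz_representation)
      (rule bounded_linear_compose[OF rinner.bounded_linear_left blinfun.bounded_linear_right])
  then obtain B where B: "\<And>x y. rinner (A x) y = rinner x (B y)" by metis
  have "bounded_linear B"
  proof (rule bounded_linear_intro[where K = "norm A"])
    show "B (x + y) = B x + B y" for x y
      by (rule rinner_ext) (simp add: B[symmetric] rinner_add_right)
    show "B (r *\<^sub>R x) = r *\<^sub>R B x" for r x
      by (rule rinner_ext) (simp add: B[symmetric] rinner_scaleR_right)
    show "norm (B x) \<le> norm x * norm A" for x
    proof -
      have "(norm (B x))\<^sup>2 = rinner (A (B x)) x"
        by (simp add: B rinner_self)
      also have "\<dots> \<le> norm A * norm (B x) * norm x"
        by (rule order_trans[OF rinner_le]) (intro mult_right_mono norm_blinfun norm_ge_zero)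
      finally show ?thesis by (cases "B x = 0") (auto simp: power2_eq_square mult_ac)
    qed
  qed
  hence app: "blinfun_apply (Blinfun B) = B" by (rule bounded_linear_Blinfun_apply)
  have Bi: "B (\<i> *\<^sub>C y) = \<i> *\<^sub>C B y" for y
  proof (rule rinner_ext)
    fix x
    have move: "rinner u (\<i> *\<^sub>C v) = - rinner (\<i> *\<^sub>C u) v" for u v :: 'a
      by (simp add: rinner_def cinner_scaleC_left cinner_scaleC_right)
    show "rinner x (B (\<i> *\<^sub>C y)) = rinner x (\<i> *\<^sub>C B y)"
      using assms by (simp add: B[symmetric] move complex_linear_def)
  qed
  have adj: "\<forall>x y. cinner (A x) y = cinner x (Blinfun B y)"
    by (simp add: app cinner_eq_rinner B Bi)
  have "hadjoint A = Blinfun B"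
    unfolding hadjoint_def
  proof (rule the_equality)
    fix C assume C: "\<forall>x y. cinner (A x) y = cinner x (blinfun_apply C y)"
    show "C = Blinfun B"
      by (rule blinfun_eqI, rule rinner_ext) (simp add: rinner_def C[rule_format, symmetric] adj[rule_format, symmetric])
  qed (rule adj)
  thus ?thesis using adj by simp
qed

text \<open>For complex linear operators, symmetry for the real inner product gives symmetry for the
  complex one, whose imaginary part is the real inner product with a multiple by \<open>\<i>\<close>.\<close>

lemma self_adjoint_iff_rinner:
  "self_adjoint A \<longleftrightarrow> complex_linear A \<and> (\<forall>x y. rinner (A x) y = rinner x (A y))"
proof
  assume "self_adjoint A"
  thus "complex_linear A \<and> (\<forall>x y. rinner (A x) y = rinner x (A y))"
    unfolding self_adjoint_def rinner_def by (metis cinner_hadjoint)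
next
  assume R: "complex_linear A \<and> (\<forall>x y. rinner (A x) y = rinner x (A y))"
  have "\<forall>x y. cinner (A x) y = cinner x (A y)"
  proof (intro allI)
    fix x y
    have "A (\<i> *\<^sub>C y) = \<i> *\<^sub>C A y" using R by (simp add: complex_linear_def)
    with R show "cinner (A x) y = cinner x (A y)" by (simp add: cinner_eq_rinner)
  qed
  hence "hadjoint A y = A y" for y
    by (intro rinner_ext) (metis rinner_def R cinner_hadjoint)
  thus "self_adjoint A" using R by (auto simp: self_adjoint_def intro: blinfun_eqI)
qed

section \<open>Coercive operators and the location of the spectrum\<close>

text \<open>For small \<open>\<rho> > 0\<close>, coercivity makes \<open>x \<mapsto> x - \<rho> (S x - y)\<close> a contraction, whose fixed point
  solves \<open>S x = y\<close>.\<close>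

lemma coercive_ex1:
  fixes S :: "'a::complex_hilbert \<Rightarrow> 'a"
  assumes "bounded_linear S" and "0 < d" and coercive: "\<And>x. d * (norm x)\<^sup>2 \<le> rinner (S x) x"
  shows "\<exists>!x. S x = y"
proof -
  interpret S: bounded_linear S by fact
  obtain K0 where K0: "\<And>x. norm (S x) \<le> norm x * K0" using S.bounded by blast
  define K where "K = max K0 d"
  have K: "norm (S x) \<le> K * norm x" for x
    using K0[of x] mult_left_mono[of K0 K "norm x"] by (simp add: K_def mult_ac)
  have dK: "0 < K" "d \<le> K" using \<open>0 < d\<close> by (auto simp: K_def)
  \<comment> \<open>the minimiser of \<open>1 - 2 * \<rho> * d + \<rho>\<^sup>2 * K\<^sup>2\<close>, with the minimum \<open>c\<^sup>2\<close>\<close>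
  define \<rho> where "\<rho> = d / K\<^sup>2"
  have \<rho>: "\<rho> \<noteq> 0" "0 \<le> \<rho>" using dK \<open>0 < d\<close> by (auto simp: \<rho>_def)
  define c where "c = sqrt (1 - d\<^sup>2 / K\<^sup>2)"
  have "d\<^sup>2 / K\<^sup>2 \<le> 1" using dK \<open>0 < d\<close> by (simp add: power_mono)
  hence c: "0 \<le> c" "c < 1" "c\<^sup>2 = 1 - d\<^sup>2 / K\<^sup>2" using dK \<open>0 < d\<close> by (auto simp: c_def)
  have contract: "norm (x - \<rho> *\<^sub>R S x) \<le> c * norm x" for x
  proof (rule power2_le_imp_le)
    have "(norm (x - \<rho> *\<^sub>R S x))\<^sup>2 = (norm x)\<^sup>2 - 2 * \<rho> * rinner (S x) x + \<rho>\<^sup>2 * (norm (S x))\<^sup>2"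
      unfolding norm_diff_square
      by (simp add: rinner_scaleR_right rinner_commute power_mult_distrib)
    also have "\<dots> \<le> (norm x)\<^sup>2 - 2 * \<rho> * (d * (norm x)\<^sup>2) + \<rho>\<^sup>2 * (K * norm x)\<^sup>2"
      using coercive \<rho> K by (intro add_mono diff_mono mult_left_mono power_mono) auto
    also have "\<dots> = (c * norm x)\<^sup>2"
      unfolding power_mult_distrib c(3) \<rho>_def using dK by (simp add: field_simps power2_eq_square)
    finally show "(norm (x - \<rho> *\<^sub>R S x))\<^sup>2 \<le> (c * norm x)\<^sup>2" .
  qed (use c in simp)
  have "\<exists>!x. x - \<rho> *\<^sub>R (S x - y) = x"
  proof (rule banach_fix_type[OF c(1,2)], intro allI)
    fix u v
    show "dist (u - \<rho> *\<^sub>R (S u - y)) (v - \<rho> *\<^sub>R (S v - y)) \<le> c * dist u v"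
      using contract[of "u - v"] by (simp add: dist_norm S.diff algebra_simps)
  qed
  thus ?thesis using \<rho> by simp
qed

text \<open>The factor \<open>u\<close> rotates the numerical range of \<open>z - X\<close> into a right half plane.\<close>

lemma not_in_spectrum:
  fixes X :: "'a::complex_hilbert \<Rightarrow>\<^sub>L 'a"
  assumes X: "complex_linear X" and "u \<noteq> 0" and d: "0 < d"
    and coercive: "\<And>x. d * (norm x)\<^sup>2 \<le> Re (u * cinner (z *\<^sub>C x - X x) x)"
  shows "z \<notin> op_spectrum X"
proof -
  have scaleC_diff: "c *\<^sub>C (x - y) = c *\<^sub>C x - c *\<^sub>C y" for c and x y :: 'a
    by (metis scaleC_add_right diff_add_cancel eq_diff_eq)
  have one: "1 *\<^sub>C x = x" for x :: 'a using scaleR_scaleC[of 1 x] by simp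
  define S where "S x = u *\<^sub>C (z *\<^sub>C x - X x)" for x
  have norm_scaleC: "norm (c *\<^sub>C x) = cmod c * norm x" for c and x :: 'a
  proof -
    have "complex_of_real ((norm (c *\<^sub>C x))\<^sup>2) = c * cnj c * cinner x x"
      unfolding cinner_self[symmetric]
      by (simp add: cinner_scaleC_left cinner_scaleC_right)
    also have "\<dots> = complex_of_real ((cmod c * norm x)\<^sup>2)"
      by (simp add: cinner_self power_mult_distrib flip: complex_norm_square)
    finally have "complex_of_real ((norm (c *\<^sub>C x))\<^sup>2) = complex_of_real ((cmod c * norm x)\<^sup>2)" .
    hence "(norm (c *\<^sub>C x))\<^sup>2 = (cmod c * norm x)\<^sup>2" by (simp only: of_real_eq_iff)
    thus ?thesis by (simp add: power2_eq_iff_nonneg)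
  qed
  have bl_scaleC: "bounded_linear (\<lambda>x::'a. c *\<^sub>C x)" for c
    by (rule bounded_linear_intro[where K = "cmod c"])
      (simp_all add: scaleC_add_right scaleR_scaleC scaleC_scaleC norm_scaleC mult.commute)
  have S: "bounded_linear S"
    unfolding S_def
    by (intro bounded_linear_compose[OF bl_scaleC] bounded_linear_sub bl_scaleC
        blinfun.bounded_linear_right)
  have S_coercive: "d * (norm x)\<^sup>2 \<le> rinner (S x) x" for x
    using coercive[of x] by (simp add: S_def rinner_def cinner_scaleC_left)
  have S_scaleC: "S (c *\<^sub>C x) = c *\<^sub>C S x" for c x
    using X by (simp add: S_def complex_linear_def scaleC_diff scaleC_scaleC mult_ac)
  interpret S: bounded_linear S by fact
  have ex1: "\<exists>!x. S x = y" for y by (rule coercive_ex1[OF S d S_coercive])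
  have inj: "x = y" if "S x = S y" for x y using ex1 that by metis
  obtain R where R: "\<And>y. S (R y) = y" using ex1 by metis
  have "bounded_linear R"
  proof (rule bounded_linear_intro[where K = "1 / d"])
    show "R (x + y) = R x + R y" for x y by (rule inj) (simp add: R S.add)
    show "R (r *\<^sub>R x) = r *\<^sub>R R x" for r x by (rule inj) (simp add: R S.scaleR)
    show "norm (R x) \<le> norm x * (1 / d)" for x
    proof -
      have "d * (norm (R x))\<^sup>2 \<le> norm x * norm (R x)"
        using S_coercive[of "R x"] rinner_le[of x "R x"] by (simp add: R)
      thus ?thesis using d by (cases "R x = 0") (auto simp: power2_eq_square field_simps)
    qed
  qed
  hence "bounded_linear (\<lambda>y. R (u *\<^sub>C y))"
    by (rule bounded_linear_compose[OF _ bl_scaleC])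
  then obtain C where C: "\<And>y. blinfun_apply C y = R (u *\<^sub>C y)"
    by (metis bounded_linear_Blinfun_apply)
  have R_scaleC: "R (c *\<^sub>C x) = c *\<^sub>C R x" for c x by (rule inj) (simp add: R S_scaleC)
  have "\<exists>C. complex_linear C \<and> (\<forall>x. C (z *\<^sub>C x - X x) = x) \<and> (\<forall>x. z *\<^sub>C C x - X (C x) = x)"
  proof (intro exI[of _ C] conjI allI)
    show "complex_linear (C)"
      by (simp add: complex_linear_def C R_scaleC scaleC_scaleC
          mult_ac)
    show "C (z *\<^sub>C x - X x) = x" for x
      unfolding C by (rule inj) (simp add: R, simp add: S_def)
    show "z *\<^sub>C C x - X (C x) = x" for x
    proof -
      have "inverse u *\<^sub>C S (R (u *\<^sub>C x)) = inverse u *\<^sub>C u *\<^sub>C x" by (simp only: R)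
      thus ?thesis unfolding C S_def
        using \<open>u \<noteq> 0\<close> by (simp add: scaleC_scaleC one)
    qed
  qed
  thus ?thesis by (simp add: op_spectrum_def)
qed

text \<open>The quadratic form \<open>q\<close> of \<open>X\<close> is real, so \<open>z - q\<close> stays away from \<open>0\<close> when \<open>z\<close> is not real
  and when \<open>z\<close> is real and outside \<open>{a..b}\<close>.\<close>

lemma spectrum_subset_interval:
  assumes X: "self_adjoint X"
    and lower: "\<And>x. a * (norm x)\<^sup>2 \<le> rinner (X x) x"
    and upper: "\<And>x. rinner (X x) x \<le> b * (norm x)\<^sup>2"
  shows "op_spectrum X \<subseteq> complex_of_real ` {a..b}"
proof
  fix z assume z: "z \<in> op_spectrum X"
  have cl: "complex_linear X" using X by (simp add: self_adjoint_def)
  have form: "cinner (z *\<^sub>C x - X x) x = z * (norm x)\<^sup>2 - rinner (X x) x" for x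
  proof -
    have "cinner (X x) x = cinner x (X x)"
      using cinner_hadjoint[OF cl, of x x] X by (simp add: self_adjoint_def)
    hence "cinner (X x) x = cnj (cinner (X x) x)" by (metis cinner_commute)
    hence "cinner (X x) x = rinner (X x) x" by (auto simp: rinner_def complex_eq_iff)
    moreover have "cinner (z *\<^sub>C x - X x) x = cinner (z *\<^sub>C x) x - cinner (X x) x"
      by (metis cinner_add_left diff_add_cancel eq_diff_eq)
    ultimately show ?thesis by (simp add: cinner_scaleC_left cinner_self)
  qed
  have "Im z = 0"
  proof (rule ccontr)
    assume "Im z \<noteq> 0"
    hence "z \<notin> op_spectrum X"
      \<comment> \<open>multiplication by \<open>- \<i> * Im z\<close> turns the imaginary part \<open>Im z\<close> into the real part \<open>(Im z)\<^sup>2\<close>\<close>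
      by (intro not_in_spectrum[OF cl, of "Complex 0 (- Im z)" "(Im z)\<^sup>2"])
        (auto simp: form complex_eq_iff power2_eq_square zero_less_mult_iff)
    with z show False by simp
  qed
  moreover have "a \<le> Re z"
  proof (rule ccontr)
    assume "\<not> a \<le> Re z"
    hence "z \<notin> op_spectrum X" using lower
      by (intro not_in_spectrum[OF cl, of "-1" "a - Re z"]) (auto simp: form algebra_simps)
    with z show False by simp
  qed
  moreover have "Re z \<le> b"
  proof (rule ccontr)
    assume "\<not> Re z \<le> b"
    hence "z \<notin> op_spectrum X" using upper
      by (intro not_in_spectrum[OF cl, of 1 "Re z - b"]) (auto simp: form algebra_simps)
    with z show False by simp
  qed
  ultimately show "z \<in> complex_of_real ` {a..b}"
    by (intro image_eqI[of _ _ "Re z"]) (auto simp: complex_eq_iff)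
qed

lemma rinner_blinfun_le:
  fixes X :: "'a::complex_hilbert \<Rightarrow>\<^sub>L 'a"
  shows "rinner (X x) x \<le> norm X * (norm x)\<^sup>2"
proof -
  have "rinner (X x) x \<le> norm X * norm x * norm x"
    by (rule order_trans[OF rinner_le]) (intro mult_right_mono norm_blinfun norm_ge_zero)
  thus ?thesis by (simp add: power2_eq_square)
qed

lemma positive_op_iff: "positive_op X \<longleftrightarrow> self_adjoint X \<and> (\<forall>x. 0 \<le> rinner (X x) x)"
  by (simp add: positive_op_def rinner_def)

lemma positive_op_spectrum:
  assumes "positive_op X" and "\<And>x. rinner (X x) x \<le> b * (norm x)\<^sup>2"
  shows "op_spectrum X \<subseteq> complex_of_real ` {0..b}"
  using assms by (intro spectrum_subset_interval) (auto simp: positive_op_iff)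

section \<open>Polynomials in a self-adjoint operator\<close>

interpretation blinfun_compose: bounded_bilinear "(o\<^sub>L)"
  by (rule bounded_bilinear_blinfun_compose)

lemma op_poly_0 [simp]: "op_poly 0 X = 0"
  by (simp add: op_poly_def)

lemma op_poly_pCons: "op_poly (pCons a p) X = a *\<^sub>R id_blinfun + (X o\<^sub>L op_poly p X)"
proof -
  have "op_poly (pCons a p) X =
      (\<Sum>i\<le>Suc (degree p). coeff (pCons a p) i *\<^sub>R (((o\<^sub>L) X ^^ i) id_blinfun))"
    unfolding op_poly_def
    by (rule sum.mono_neutral_left) (auto simp: degree_pCons_le coeff_eq_0)
  also have "\<dots> = a *\<^sub>R id_blinfun + (X o\<^sub>L op_poly p X)"
    unfolding op_poly_def
    by (simp del: sum.atMost_Suc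
        add: sum.atMost_Suc_shift blinfun_compose.sum_right blinfun_compose.scaleR_right)
  finally show ?thesis .
qed

lemma op_poly_const: "op_poly [:c:] X = c *\<^sub>R id_blinfun"
  by (simp add: op_poly_pCons)

lemma op_poly_X: "op_poly [:0, 1:] X = X"
  by (rule blinfun_eqI) (simp add: op_poly_pCons)

lemma op_poly_add: "op_poly (p + q) X = op_poly p X + op_poly q X"
  by (induction p q rule: poly_induct2)
    (simp_all add: op_poly_pCons blinfun_compose.add_right scaleR_add_left)

lemma op_poly_smult: "op_poly (smult c p) X = c *\<^sub>R op_poly p X"
  by (induction p)
    (simp_all add: op_poly_pCons blinfun_compose.scaleR_right scaleR_add_right)

lemma op_poly_diff: "op_poly (p - q) X = op_poly p X - op_poly q X"
  using op_poly_add[of "p - q" q X] by simp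

lemma op_poly_mult: "op_poly (p * q) X = op_poly p X o\<^sub>L op_poly q X"
proof (induction p)
  case (pCons a p)
  show ?case
    by (rule blinfun_eqI)
      (simp add: pCons op_poly_pCons op_poly_add op_poly_smult blinfun.bilinear_simps)
qed simp

lemma op_poly_commute: "X (op_poly p X x) = op_poly p X (X x)"
proof -
  have "op_poly ([:0, 1:] * p) X x = op_poly (p * [:0, 1:]) X x" by (simp only: mult.commute)
  thus ?thesis by (simp only: op_poly_mult op_poly_X blinfun_apply_blinfun_compose)
qed

lemma self_adjoint_0: "self_adjoint 0"
proof -
  have "(0::'a) = c *\<^sub>C 0" for c
    by (metis add_cancel_right_right scaleC_add_right)
  thus ?thesis by (simp add: self_adjoint_iff_rinner complex_linear_def
        rinner.zero_left rinner.zero_right)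
qed

lemma self_adjoint_add: "self_adjoint X \<Longrightarrow> self_adjoint Y \<Longrightarrow> self_adjoint (X + Y)"
  by (simp add: self_adjoint_iff_rinner complex_linear_def blinfun.add_left rinner_add_left
      rinner_add_right scaleC_add_right)

lemma self_adjoint_scaleR: "self_adjoint X \<Longrightarrow> self_adjoint (r *\<^sub>R X)"
proof -
  assume X: "self_adjoint X"
  hence "complex_linear (r *\<^sub>R X)"
    by (simp add: self_adjoint_def complex_linear_def blinfun.scaleR_left scaleR_scaleC
        scaleC_scaleC mult.commute)
  thus ?thesis using X
    by (simp add: self_adjoint_iff_rinner blinfun.scaleR_left rinner_scaleR_left
        rinner_scaleR_right)
qed

lemma self_adjoint_id: "self_adjoint id_blinfun"
  by (simp add: self_adjoint_iff_rinner complex_linear_def)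

lemma self_adjoint_op_poly:
  assumes "self_adjoint X"
  shows "self_adjoint (op_poly p X)"
proof (induction p)
  case (pCons a p)
  have "self_adjoint (X o\<^sub>L op_poly p X)"
    using assms pCons(2) by (simp add: self_adjoint_iff_rinner complex_linear_def op_poly_commute)
  thus ?case
    unfolding op_poly_pCons by (intro self_adjoint_add self_adjoint_scaleR self_adjoint_id)
qed (simp add: self_adjoint_0)

definition bounded_below :: "('a::real_normed_vector \<Rightarrow>\<^sub>L 'a) \<Rightarrow> bool"
  where "bounded_below T \<longleftrightarrow> (\<exists>c>0. \<forall>x. c * norm x \<le> norm (T x))"

lemma bounded_below_compose:
  assumes "bounded_below S" "bounded_below T"
  shows "bounded_below (S o\<^sub>L T)"
proof -
  obtain c d where c: "0 < c" "\<And>x. c * norm x \<le> norm (S x)"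
    and d: "0 < d" "\<And>x. d * norm x \<le> norm (T x)"
    using assms by (auto simp: bounded_below_def)
  have "c * d * norm x \<le> norm (S (T x))" for x
    using order_trans[OF mult_left_mono[OF d(2)] c(2)] c(1) by (simp add: mult.assoc)
  thus ?thesis using c(1) d(1) by (auto simp: bounded_below_def intro!: exI[of _ "c * d"])
qed

text \<open>A bounded inverse \<open>C\<close> would give the lower bound \<open>1 / norm C\<close>; adding \<open>1\<close> to the norm keeps the
  constant finite on the zero space.\<close>

lemma not_bounded_below_in_spectrum:
  assumes "\<not> bounded_below (X - r *\<^sub>R id_blinfun)"
  shows "complex_of_real r \<in> op_spectrum X"
proof (rule ccontr)
  assume "complex_of_real r \<notin> op_spectrum X"
  then obtain C :: "'a \<Rightarrow>\<^sub>L 'a" where C: "\<And>x. C (r *\<^sub>R x - X x) = x"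
    by (auto simp: op_spectrum_def scaleR_scaleC)
  have "norm x \<le> (norm C + 1) * norm ((X - r *\<^sub>R id_blinfun) x)" for x
  proof -
    have "norm x \<le> norm C * norm (r *\<^sub>R x - X x)" using norm_blinfun[of C "r *\<^sub>R x - X x"] C by simp
    also have "\<dots> \<le> (norm C + 1) * norm (r *\<^sub>R x - X x)" by (intro mult_right_mono) auto
    finally show ?thesis by (simp add: blinfun.bilinear_simps norm_minus_commute)
  qed
  hence "bounded_below (X - r *\<^sub>R id_blinfun)"
    unfolding bounded_below_def
    by (intro exI[of _ "1 / (norm C + 1)"])
      (auto simp: field_simps add_pos_nonneg add_nonneg_pos)
  with assms show False by simp
qed

text \<open>Dividing \<open>p\<close> by the real quadratic with the roots \<open>z\<close> and \<open>cnj z\<close> leaves a remainder of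
  degree at most one, which has no non-real root unless it is zero.\<close>

lemma real_quadratic_dvd:
  fixes p :: "real poly"
  assumes "poly (map_poly complex_of_real p) z = 0" and "Im z \<noteq> 0"
  shows "[:(cmod z)\<^sup>2, - 2 * Re z, 1:] dvd p"
proof -
  define q where "q = [:(cmod z)\<^sup>2, - 2 * Re z, 1:]"
  have q: "poly (map_poly complex_of_real q) z = 0"
    unfolding q_def cmod_power2
    by (simp add: map_poly_pCons complex_eq_iff power2_eq_square algebra_simps)
  have "map_poly complex_of_real (a * b + c) =
      map_poly complex_of_real a * map_poly complex_of_real b + map_poly complex_of_real c" for a b c
    by (rule poly_eqI) (simp add: coeff_map_poly coeff_mult)
  hence "map_poly complex_of_real p =
      map_poly complex_of_real q * map_poly complex_of_real (p div q)
      + map_poly complex_of_real (p mod q)"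
    by (metis mult_div_mod_eq)
  hence r: "poly (map_poly complex_of_real (p mod q)) z = 0"
    using assms q by simp
  have "degree (p mod q) < 2"
    using degree_mod_less[of q p] by (auto simp: q_def)
  then obtain a b where ab: "p mod q = [:a, b:]"
    by (metis degree_eq_zeroE less_2_cases pCons_0_0 degree1_coeffs One_nat_def)
  have "a = 0 \<and> b = 0" using r assms(2) by (auto simp: ab map_poly_pCons complex_eq_iff)
  thus ?thesis using ab by (auto simp: q_def dvd_eq_mod_eq_0)
qed

text \<open>A real polynomial splits into linear factors and quadratic factors
  \<open>(t - a)\<^sup>2 + b\<^sup>2\<close> with \<open>b \<noteq> 0\<close>.  The latter are always bounded below at a self-adjoint operator.\<close>

lemma op_poly_bounded_below:
  fixes X :: "'a::complex_hilbert \<Rightarrow>\<^sub>L 'a"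
  assumes X: "self_adjoint X" and "p \<noteq> 0"
    and "\<And>r. poly p r = 0 \<Longrightarrow> bounded_below (X - r *\<^sub>R id_blinfun)"
  shows "bounded_below (op_poly p X)"
  using assms(2,3)
proof (induction "degree p" arbitrary: p rule: less_induct)
  case less
  have factor: "bounded_below (op_poly p X)"
    if p: "p = l * q" and "0 < degree l" "bounded_below (op_poly l X)" for l q
  proof -
    have "q \<noteq> 0" "l \<noteq> 0" using less.prems(1) p by auto
    hence "degree q < degree p" using that by (simp add: degree_mult_eq)
    hence "bounded_below (op_poly q X)"
      using less.prems(2) p \<open>q \<noteq> 0\<close> by (intro less.hyps) auto
    thus ?thesis using that by (simp add: p op_poly_mult bounded_below_compose)
  qed
  show ?case
  proof (cases "degree p = 0")
    case True
    then obtain c where "p = [:c:]" by (rule degree_eq_zeroE)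
    thus ?thesis using less.prems(1)
      by (auto simp: bounded_below_def op_poly_const blinfun.scaleR_left intro!: exI[of _ "\<bar>c\<bar>"])
  next
    case False
    hence "degree (map_poly complex_of_real p) \<noteq> 0" by (simp add: degree_map_poly)
    then obtain z where z: "poly (map_poly complex_of_real p) z = 0"
      using fundamental_theorem_of_algebra_alt[of "map_poly complex_of_real p"]
      by (metis degree_pCons_0)
    show ?thesis
    proof (cases "Im z = 0")
      case True
      hence "z = of_real (Re z)" by (simp add: complex_eq_iff)
      moreover have "poly (map_poly complex_of_real p) (of_real r) = of_real (poly p r)" for r
        by (induction p) (auto simp: map_poly_pCons)
      ultimately have root: "poly p (Re z) = 0" using z by (metis of_real_eq_0_iff)
      then obtain q where q: "p = [:- Re z, 1:] * q" by (auto simp: poly_eq_0_iff_dvd)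
      have "op_poly [:- Re z, 1:] X = X - Re z *\<^sub>R id_blinfun"
        by (rule blinfun_eqI) (simp add: op_poly_pCons blinfun.bilinear_simps)
      thus ?thesis using less.prems(2)[OF root] by (intro factor[OF q]) auto
    next
      case False
      define l where "l = [:(cmod z)\<^sup>2, - 2 * Re z, 1:]"
      obtain q where q: "p = l * q"
        using real_quadratic_dvd[OF z False] by (auto simp: l_def)
      have "bounded_below (op_poly l X)"
        unfolding bounded_below_def
      proof (intro exI conjI allI)
        show "0 < (Im z)\<^sup>2" using False by simp
        fix x
        define y where "y = X x - Re z *\<^sub>R x"
        have "op_poly l X x = X (X x) - (2 * Re z) *\<^sub>R X x + ((Re z)\<^sup>2 + (Im z)\<^sup>2) *\<^sub>R x"
          by (simp add: l_def op_poly_pCons blinfun.bilinear_simps cmod_power2)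
        also have "\<dots> = (X y - Re z *\<^sub>R y) + (Im z)\<^sup>2 *\<^sub>R x"
          unfolding mult_2 scaleR_add_left
          by (simp add: y_def blinfun.bilinear_simps scaleR_diff_right power2_eq_square)
        finally have "op_poly l X x = (X y - Re z *\<^sub>R y) + (Im z)\<^sup>2 *\<^sub>R x" .
        hence "rinner (op_poly l X x) x = (norm y)\<^sup>2 + (Im z)\<^sup>2 * (norm x)\<^sup>2"
          using X by (simp add: self_adjoint_iff_rinner rinner_add_left rinner_scaleR_left
              rinner.diff_left rinner.diff_right rinner_scaleR_right y_def rinner_self[symmetric])
        hence "(Im z)\<^sup>2 * (norm x)\<^sup>2 \<le> norm (op_poly l X x) * norm x"
          using rinner_le[of "op_poly l X x" x] zero_le_power2[of "norm y"] by linarith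
        thus "(Im z)\<^sup>2 * norm x \<le> norm (op_poly l X x)"
          by (cases "x = 0") (auto simp: power2_eq_square)
      qed
      thus ?thesis by (intro factor[OF q]) (auto simp: l_def)
    qed
  qed
qed

text \<open>On vectors \<open>x\<close> at which \<open>S\<close> almost attains its norm, \<open>S\<^sup>2 x\<close> is close to
  \<open>(norm S)\<^sup>2 *\<^sub>R x\<close>.\<close>

lemma self_adjoint_norm_not_bounded_below:
  fixes S :: "'a::complex_hilbert \<Rightarrow>\<^sub>L 'a"
  assumes S: "self_adjoint S" and "(v::'a) \<noteq> 0"
  shows "\<not> bounded_below ((S o\<^sub>L S) - (norm S)\<^sup>2 *\<^sub>R id_blinfun)"
proof (cases "S = 0")
  case True
  have "\<not> c * norm v \<le> 0" if "0 < c" for c using that assms(2) by (simp add: not_le)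
  thus ?thesis by (auto simp: True bounded_below_def)
next
  case False
  define N where "N = norm S"
  have N: "0 < N" using False by (simp add: N_def)
  show ?thesis
  proof
    assume "bounded_below ((S o\<^sub>L S) - (norm S)\<^sup>2 *\<^sub>R id_blinfun)"
    then obtain c where c: "0 < c" "\<And>x. c * norm x \<le> norm (S (S x) - N\<^sup>2 *\<^sub>R x)"
      by (auto simp: bounded_below_def N_def blinfun.bilinear_simps)
    define e where "e = max 0 (N\<^sup>2 - c\<^sup>2 / N\<^sup>2)"
    have e: "0 \<le> e" "e < N\<^sup>2" using c N by (auto simp: e_def)
    have "norm (S x) \<le> sqrt e * norm x" for x
    proof (rule power2_le_imp_le)
      have "rinner (S (S x)) x = (norm (S x))\<^sup>2"
        using S by (simp add: self_adjoint_iff_rinner rinner_self)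
      hence "(norm (S (S x) - N\<^sup>2 *\<^sub>R x))\<^sup>2 =
          (norm (S (S x)))\<^sup>2 - 2 * N\<^sup>2 * (norm (S x))\<^sup>2 + N\<^sup>2 * N\<^sup>2 * (norm x)\<^sup>2"
        unfolding norm_diff_square rinner_scaleR_right norm_scaleR power_mult_distrib power2_abs
        by (simp add: power2_eq_square)
      moreover have "(norm (S (S x)))\<^sup>2 \<le> (N * norm (S x))\<^sup>2"
        unfolding N_def by (intro power_mono norm_blinfun norm_ge_zero)
      moreover have "(c * norm x)\<^sup>2 \<le> (norm (S (S x) - N\<^sup>2 *\<^sub>R x))\<^sup>2"
        using c by (intro power_mono) auto
      ultimately have "c\<^sup>2 * (norm x)\<^sup>2 \<le> N\<^sup>2 * N\<^sup>2 * (norm x)\<^sup>2 - N\<^sup>2 * (norm (S x))\<^sup>2"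
        unfolding power_mult_distrib by linarith
      hence "(norm (S x))\<^sup>2 \<le> (N\<^sup>2 - c\<^sup>2 / N\<^sup>2) * (norm x)\<^sup>2"
        using N by (simp add: field_simps)
      also have "\<dots> \<le> e * (norm x)\<^sup>2" by (intro mult_right_mono) (auto simp: e_def)
      finally show "(norm (S x))\<^sup>2 \<le> (sqrt e * norm x)\<^sup>2"
        using e by (simp add: power_mult_distrib)
    qed (use e in simp)
    hence "N \<le> sqrt e" unfolding N_def using e by (intro norm_blinfun_bound) auto
    also have "sqrt e < N" using e N by (intro real_less_lsqrt) auto
    finally show False by simp
  qed
qed

lemma op_poly_root_in_spectrum:
  assumes "self_adjoint X" "p \<noteq> 0" "\<not> bounded_below (op_poly p X)"
  shows "\<exists>r. poly p r = 0 \<and> complex_of_real r \<in> op_spectrum X"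
  using op_poly_bounded_below[OF assms(1,2)] assms(3) not_bounded_below_in_spectrum by blast

text \<open>The vector \<open>v\<close> excludes the zero space, on which every spectrum is empty.\<close>

lemma self_adjoint_spectrum_nonempty:
  fixes X :: "'a::complex_hilbert \<Rightarrow>\<^sub>L 'a"
  assumes X: "self_adjoint X" and v: "(v::'a) \<noteq> 0"
  shows "\<exists>r. complex_of_real r \<in> op_spectrum X"
proof -
  have "op_poly [:- (norm X)\<^sup>2, 0, 1:] X = (X o\<^sub>L X) - (norm X)\<^sup>2 *\<^sub>R id_blinfun"
    by (rule blinfun_eqI) (simp add: op_poly_pCons blinfun.bilinear_simps)
  thus ?thesis
    using op_poly_root_in_spectrum[OF X, of "[:- (norm X)\<^sup>2, 0, 1:]"]
      self_adjoint_norm_not_bounded_below[OF X v] by auto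
qed

text \<open>A quantitative spectral mapping theorem: with \<open>N = norm (p(X))\<close>, the polynomial
  \<open>p\<^sup>2 - N\<^sup>2\<close> is not bounded below at \<open>X\<close>, so it has a root in the spectrum, or it vanishes
  identically.\<close>

lemma norm_op_poly_attained:
  fixes X :: "'a::complex_hilbert \<Rightarrow>\<^sub>L 'a"
  assumes X: "self_adjoint X" and v: "(v::'a) \<noteq> 0"
  shows "\<exists>r. complex_of_real r \<in> op_spectrum X \<and> \<bar>poly p r\<bar> = norm (op_poly p X)"
proof -
  define N where "N = norm (op_poly p X)"
  define P where "P = p * p - [:N\<^sup>2:]"
  have "op_poly P X = (op_poly p X o\<^sub>L op_poly p X) - N\<^sup>2 *\<^sub>R id_blinfun"
    by (simp add: P_def op_poly_diff op_poly_mult op_poly_const)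
  hence "\<not> bounded_below (op_poly P X)"
    using self_adjoint_norm_not_bounded_below[OF self_adjoint_op_poly[OF X] v]
    by (simp add: N_def)
  then obtain r where r: "poly P r = 0" "complex_of_real r \<in> op_spectrum X"
    using op_poly_root_in_spectrum[OF X, of P] self_adjoint_spectrum_nonempty[OF X v]
    by (cases "P = 0") auto
  have "\<bar>poly p r\<bar> = \<bar>N\<bar>"
    using r(1) by (simp add: P_def power2_eq_square abs_eq_iff square_eq_iff)
  thus ?thesis using r(2) by (auto simp: N_def)
qed

lemma norm_op_poly_le:
  fixes X :: "'a::complex_hilbert \<Rightarrow>\<^sub>L 'a"
  assumes X: "self_adjoint X" and "0 \<le> c"
    and "\<And>r. complex_of_real r \<in> op_spectrum X \<Longrightarrow> \<bar>poly p r\<bar> \<le> c"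
  shows "norm (op_poly p X) \<le> c"
proof (cases "\<exists>v::'a. v \<noteq> 0")
  case True
  thus ?thesis using norm_op_poly_attained[OF X] assms(3) by metis
next
  case False
  hence "op_poly p X = 0" by (intro blinfun_eqI) simp
  thus ?thesis using assms(2) by simp
qed

section \<open>Continuous functional calculus\<close>

abbreviation real_spectrum :: "('a::complex_hilbert \<Rightarrow>\<^sub>L 'a) \<Rightarrow> real set"
  where "real_spectrum X \<equiv> {r. complex_of_real r \<in> op_spectrum X}"

lemma weierstrass_real_poly:
  fixes f :: "real \<Rightarrow> real"
  assumes "continuous_on {a..b} f"
  obtains p :: "nat \<Rightarrow> real poly" where "uniform_limit {a..b} (\<lambda>n. poly (p n)) f sequentially"
proof -
  obtain g where g: "uniform_limit {a..b} g f sequentially" "\<And>n. polynomial_function (g n)"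
    using Stone_Weierstrass_uniform_limit[OF compact_Icc assms] by blast
  have "\<exists>p. g n = poly p" for n
  proof -
    obtain c and k :: nat where "g n = (\<lambda>x. \<Sum>i\<le>k. c i * x ^ i)"
      using g(2)[of n] real_polynomial_function_imp_sum by (metis real_polynomial_function_eq)
    hence "g n = poly (\<Sum>i\<le>k. monom (c i) i)" by (simp add: fun_eq_iff poly_sum poly_monom)
    thus ?thesis by blast
  qed
  then obtain p where "\<And>n. g n = poly (p n)" by metis
  hence "g = (\<lambda>n. poly (p n))" by (simp add: fun_eq_iff)
  with g(1) show thesis using that by simp
qed

text \<open>The error \<open>e\<close> absorbs the difference of \<open>p n\<close> and \<open>f\<close>, so that \<open>q(X)\<close> can be compared with
  \<open>f(X)\<close> before \<open>f(X)\<close> is known to exist.\<close>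

lemma eventually_op_poly_close:
  fixes X :: "'a::complex_hilbert \<Rightarrow>\<^sub>L 'a"
  assumes X: "self_adjoint X" and "0 < e" "0 \<le> c"
    and p: "uniform_limit (real_spectrum X) (\<lambda>n. poly (p n)) f sequentially"
    and q: "\<And>r. r \<in> real_spectrum X \<Longrightarrow> \<bar>f r - poly q r\<bar> \<le> c"
  shows "\<forall>\<^sub>F n in sequentially. norm (op_poly (p n) X - op_poly q X) \<le> c + e"
  using uniform_limitD[OF p \<open>0 < e\<close>]
proof eventually_elim
  case (elim n)
  have "\<bar>poly (p n - q) r\<bar> \<le> c + e" if "r \<in> real_spectrum X" for r
    using bspec[OF elim that] q[OF that] by (simp add: dist_real_def)
  thus ?case using norm_op_poly_le[OF X, of "c + e" "p n - q"] assms(2,3)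
    by (simp add: op_poly_diff)
qed

lemma op_poly_convergent:
  fixes X :: "'a::complex_hilbert \<Rightarrow>\<^sub>L 'a"
  assumes X: "self_adjoint X"
    and p: "uniform_limit (real_spectrum X) (\<lambda>n. poly (p n)) f sequentially"
  shows "convergent (\<lambda>n. op_poly (p n) X)"
proof -
  have "Cauchy (\<lambda>n. op_poly (p n) X)"
  proof (rule metric_CauchyI)
    fix e :: real assume e: "0 < e"
    obtain M where M: "\<forall>r \<in> real_spectrum X. dist (poly (p M) r) (f r) < e / 8"
      using eventually_happens[OF uniform_limitD[OF p, of "e / 8"]] e by auto
    hence "\<forall>\<^sub>F n in sequentially. norm (op_poly (p n) X - op_poly (p M) X) \<le> e / 8 + e / 8"
      using e by (intro eventually_op_poly_close[OF X _ _ p])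
        (auto simp: dist_real_def abs_minus_commute less_imp_le)
    then obtain N where N: "\<And>n. N \<le> n \<Longrightarrow> norm (op_poly (p n) X - op_poly (p M) X) \<le> e / 4"
      by (auto simp: eventually_sequentially)
    have "dist (op_poly (p m) X) (op_poly (p n) X) < e" if "N \<le> m" "N \<le> n" for m n
      using dist_triangle2[of "op_poly (p m) X" "op_poly (p n) X" "op_poly (p M) X"]
        N[OF that(1)] N[OF that(2)] e by (simp add: dist_norm)
    thus "\<exists>N. \<forall>m\<ge>N. \<forall>n\<ge>N. dist (op_poly (p m) X) (op_poly (p n) X) < e" by blast
  qed
  thus ?thesis by (simp add: Cauchy_convergent_iff)
qed

lemma op_poly_limit_unique:
  fixes X :: "'a::complex_hilbert \<Rightarrow>\<^sub>L 'a"
  assumes X: "self_adjoint X"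
    and p: "uniform_limit (real_spectrum X) (\<lambda>n. poly (p n)) f sequentially"
      "(\<lambda>n. op_poly (p n) X) \<longlonglongrightarrow> Y"
    and q: "uniform_limit (real_spectrum X) (\<lambda>n. poly (q n)) f sequentially"
      "(\<lambda>n. op_poly (q n) X) \<longlonglongrightarrow> Z"
  shows "Y = Z"
proof -
  have "poly (p n - q n) = (\<lambda>r. poly (p n) r - poly (q n) r)" for n by (simp add: fun_eq_iff)
  hence "uniform_limit (real_spectrum X) (\<lambda>n. poly (p n - q n)) (\<lambda>r. 0) sequentially"
    using uniform_limit_minus[OF p(1) q(1)] by simp
  from eventually_op_poly_close[OF X _ order_refl this, of _ 0]
  have "\<forall>\<^sub>F n in sequentially. norm (op_poly (p n) X - op_poly (q n) X) \<le> e" if "0 < e" for e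
    using that by (simp add: op_poly_diff)
  moreover have "(\<lambda>n. norm (op_poly (p n) X - op_poly (q n) X)) \<longlonglongrightarrow> norm (Y - Z)"
    by (intro tendsto_intros p q)
  ultimately have "norm (Y - Z) \<le> 0 + e" if "0 < e" for e
    using tendsto_upperbound that by fastforce
  hence "norm (Y - Z) \<le> 0" by (rule field_le_epsilon)
  thus ?thesis by simp
qed

lemma fun_calc_LIMSEQ:
  assumes X: "self_adjoint X"
    and p: "uniform_limit (real_spectrum X) (\<lambda>n. poly (p n)) f sequentially"
  shows "(\<lambda>n. op_poly (p n) X) \<longlonglongrightarrow> fun_calc f X"
proof -
  obtain Y where Y: "(\<lambda>n. op_poly (p n) X) \<longlonglongrightarrow> Y"
    using op_poly_convergent[OF X p] by (auto simp: convergent_def)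
  have "fun_calc f X = Y"
    unfolding fun_calc_def
  proof (rule the_equality)
    show "\<exists>p. uniform_limit (real_spectrum X) (\<lambda>n. poly (p n)) f sequentially
        \<and> (\<lambda>n. op_poly (p n) X) \<longlonglongrightarrow> Y"
      using p Y by blast
  next
    fix Z assume "\<exists>p. uniform_limit (real_spectrum X) (\<lambda>n. poly (p n)) f sequentially
        \<and> (\<lambda>n. op_poly (p n) X) \<longlonglongrightarrow> Z"
    thus "Z = Y" using op_poly_limit_unique[OF X _ _ p Y] by blast
  qed
  with Y show ?thesis by simp
qed

lemma fun_calc_approx:
  assumes X: "self_adjoint X" and sp: "op_spectrum X \<subseteq> complex_of_real ` {a..b}"
    and f: "continuous_on {a..b} f" and "0 \<le> c"
    and q: "\<And>r. r \<in> {a..b} \<Longrightarrow> \<bar>f r - poly q r\<bar> \<le> c"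
  shows "norm (fun_calc f X - op_poly q X) \<le> c"
proof -
  obtain p where "uniform_limit {a..b} (\<lambda>n. poly (p n)) f sequentially"
    using weierstrass_real_poly[OF f] .
  hence p: "uniform_limit (real_spectrum X) (\<lambda>n. poly (p n)) f sequentially"
    by (rule uniform_limit_on_subset) (use sp in auto)
  have "norm (fun_calc f X - op_poly q X) \<le> c + e" if "0 < e" for e
  proof (rule tendsto_upperbound)
    show "(\<lambda>n. norm (op_poly (p n) X - op_poly q X)) \<longlonglongrightarrow> norm (fun_calc f X - op_poly q X)"
      by (intro tendsto_intros fun_calc_LIMSEQ X p)
    show "\<forall>\<^sub>F n in sequentially. norm (op_poly (p n) X - op_poly q X) \<le> c + e"
      by (rule eventually_op_poly_close[OF X that \<open>0 \<le> c\<close> p]) (use sp q in auto)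
  qed simp
  thus ?thesis by (rule field_le_epsilon)
qed

lemma norm_fun_calc_le:
  assumes "self_adjoint X" "op_spectrum X \<subseteq> complex_of_real ` {a..b}" "continuous_on {a..b} f"
    and "0 \<le> c" "\<And>r. r \<in> {a..b} \<Longrightarrow> \<bar>f r\<bar> \<le> c"
  shows "norm (fun_calc f X) \<le> c"
  using fun_calc_approx[OF assms(1-4), of 0] assms(5) by simp

text \<open>Both symmetry and complex linearity can be tested with real inner products, which are
  continuous in the operator.\<close>

lemma self_adjoint_LIMSEQ:
  assumes S: "\<And>n. self_adjoint (S n)" and lim: "S \<longlonglongrightarrow> Y"
  shows "self_adjoint Y"
proof -
  have l: "(\<lambda>n. rinner (S n x) y) \<longlonglongrightarrow> rinner (Y x) y" for x y
    by (intro rinner.tendsto blinfun.tendsto lim tendsto_const)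
  have scaleC_left: "rinner (c *\<^sub>C x) y = rinner x (cnj c *\<^sub>C y)" for c and x y :: 'a
    by (simp add: rinner_def cinner_scaleC_left cinner_scaleC_right)
  have "rinner (Y x) y = rinner x (Y y)" for x y
  proof (rule LIMSEQ_unique[OF l])
    show "(\<lambda>n. rinner (S n x) y) \<longlonglongrightarrow> rinner x (Y y)"
      using l[of y x] S by (simp add: self_adjoint_iff_rinner rinner_commute)
  qed
  moreover have "Y (c *\<^sub>C x) = c *\<^sub>C Y x" for c x
  proof (rule rinner_ext)
    fix y
    have "rinner (Y (c *\<^sub>C x)) y = rinner (c *\<^sub>C Y x) y"
    proof (rule LIMSEQ_unique[OF l])
      show "(\<lambda>n. rinner (S n (c *\<^sub>C x)) y) \<longlonglongrightarrow> rinner (c *\<^sub>C Y x) y"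
        using l[of x "cnj c *\<^sub>C y"] S
        by (simp add: self_adjoint_def complex_linear_def scaleC_left)
    qed
    thus "rinner y (Y (c *\<^sub>C x)) = rinner y (c *\<^sub>C Y x)" by (simp add: rinner_commute)
  qed
  ultimately show ?thesis by (simp add: self_adjoint_iff_rinner complex_linear_def)
qed

lemma self_adjoint_fun_calc:
  assumes X: "self_adjoint X" and "op_spectrum X \<subseteq> complex_of_real ` {a..b}"
    and "continuous_on {a..b} f"
  shows "self_adjoint (fun_calc f X)"
proof -
  obtain p where p: "uniform_limit {a..b} (\<lambda>n. poly (p n)) f sequentially"
    using weierstrass_real_poly[OF assms(3)] .
  have "(\<lambda>n. op_poly (p n) X) \<longlonglongrightarrow> fun_calc f X"
    by (intro fun_calc_LIMSEQ X uniform_limit_on_subset[OF p]) (use assms(2) in auto)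
  thus ?thesis by (rule self_adjoint_LIMSEQ[OF self_adjoint_op_poly[OF X]])
qed

text \<open>If \<open>0 \<le> f \<le> c\<close> on the spectrum, then \<open>f(X)\<close> is within \<open>c\<close> of \<open>c\<close> times the identity, which
  forces its quadratic form to be nonnegative.\<close>

lemma positive_op_fun_calc:
  assumes X: "self_adjoint X" and sp: "op_spectrum X \<subseteq> complex_of_real ` {a..b}"
    and f: "continuous_on {a..b} f" and nonneg: "\<And>r. r \<in> {a..b} \<Longrightarrow> 0 \<le> f r"
  shows "positive_op (fun_calc f X)"
proof -
  have "bounded (f ` {a..b})"
    by (intro compact_imp_bounded compact_continuous_image f compact_Icc)
  then obtain c where c: "0 < c" "\<And>r. r \<in> {a..b} \<Longrightarrow> \<bar>f r\<bar> \<le> c"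
    unfolding bounded_pos by auto
  have "norm (fun_calc f X - op_poly [:c:] X) \<le> c"
  proof (rule fun_calc_approx[OF X sp f])
    show "\<bar>f r - poly [:c:] r\<bar> \<le> c" if "r \<in> {a..b}" for r
      using c(2)[OF that] nonneg[OF that] by simp
  qed (use c in simp)
  hence le: "norm (c *\<^sub>R id_blinfun - fun_calc f X) \<le> c"
    by (simp add: op_poly_const norm_minus_commute)
  have "0 \<le> rinner (fun_calc f X x) x" for x
  proof -
    have "c * (norm x)\<^sup>2 - rinner (fun_calc f X x) x = rinner ((c *\<^sub>R id_blinfun - fun_calc f X) x) x"
      by (simp add: blinfun.bilinear_simps rinner.diff_left rinner_scaleR_left rinner_self)
    also have "\<dots> \<le> c * (norm x)\<^sup>2"
      by (rule order_trans[OF rinner_blinfun_le]) (intro mult_right_mono le zero_le_power2)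
    finally show ?thesis by simp
  qed
  thus ?thesis using self_adjoint_fun_calc[OF X sp f] by (simp add: positive_op_iff)
qed

lemma continuous_on_op_poly:
  assumes "continuous_on T X"
  shows "continuous_on T (\<lambda>t. op_poly p (X t))"
  by (induction p)
    (auto simp: op_poly_pCons intro!: continuous_intros blinfun_compose.continuous_on assms)

text \<open>By the norm estimate, the polynomial approximations of \<open>f(X t)\<close> are uniform in \<open>t\<close>
  as long as all spectra lie in a common compact interval.\<close>

lemma continuous_on_fun_calc:
  assumes cont: "continuous_on T X"
    and X: "\<And>t. t \<in> T \<Longrightarrow> self_adjoint (X t)"
    and sp: "\<And>t. t \<in> T \<Longrightarrow> op_spectrum (X t) \<subseteq> complex_of_real ` {a..b}"
    and f: "continuous_on {a..b} f"
  shows "continuous_on T (\<lambda>t. fun_calc f (X t))"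
proof -
  obtain p where p: "uniform_limit {a..b} (\<lambda>n. poly (p n)) f sequentially"
    using weierstrass_real_poly[OF f] .
  have "uniform_limit T (\<lambda>n t. op_poly (p n) (X t)) (\<lambda>t. fun_calc f (X t)) sequentially"
  proof (rule uniform_limitI)
    fix e :: real assume e: "0 < e"
    hence "\<forall>\<^sub>F n in sequentially. \<forall>r\<in>{a..b}. dist (poly (p n) r) (f r) < e / 2"
      by (intro uniform_limitD[OF p]) simp
    thus "\<forall>\<^sub>F n in sequentially. \<forall>t\<in>T. dist (op_poly (p n) (X t)) (fun_calc f (X t)) < e"
    proof (eventually_elim, intro ballI)
      fix n t
      assume n: "\<forall>r\<in>{a..b}. dist (poly (p n) r) (f r) < e / 2" and t: "t \<in> T"
      have "norm (fun_calc f (X t) - op_poly (p n) (X t)) \<le> e / 2"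
        using n e by (intro fun_calc_approx[OF X[OF t] sp[OF t] f])
          (auto simp: dist_real_def abs_minus_commute less_imp_le)
      thus "dist (op_poly (p n) (X t)) (fun_calc f (X t)) < e"
        using e by (simp add: dist_norm norm_minus_commute)
    qed
  qed
  thus ?thesis
    by (rule uniform_limit_theorem[rotated]) (simp_all add: continuous_on_op_poly[OF cont])
qed

text \<open>The norm of a self-adjoint operator is bounded by the moduli of the points of its spectrum, and
  the quadratic form confines the spectrum.\<close>

lemma norm_positive_op_le:
  assumes S: "positive_op S" and "0 \<le> c" and form: "\<And>x. rinner (S x) x \<le> c * (norm x)\<^sup>2"
  shows "norm S \<le> c"
proof -
  have "norm (op_poly [:0, 1:] S) \<le> c"
    using positive_op_spectrum[OF S form] S assms(2)
    by (intro norm_op_poly_le) (auto simp: positive_op_iff)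
  thus ?thesis by (simp only: op_poly_X)
qed

lemma op_le_rinner: "op_le S T \<Longrightarrow> rinner (S x) x \<le> rinner (T x) x"
  by (simp add: op_le_def positive_op_iff blinfun.bilinear_simps rinner.diff_left)

lemma norm_mono_op_le:
  assumes "positive_op S" "op_le S T"
  shows "norm S \<le> norm T"
  by (rule norm_positive_op_le[OF assms(1)])
    (auto intro: order_trans[OF op_le_rinner[OF assms(2)] rinner_blinfun_le])

lemma hadjoint_compose_self:
  fixes A :: "'a::complex_hilbert \<Rightarrow>\<^sub>L 'a"
  assumes A: "complex_linear A"
  shows "positive_op (hadjoint A o\<^sub>L A)"
    and "op_spectrum (hadjoint A o\<^sub>L A) \<subseteq> complex_of_real ` {0..(norm A)\<^sup>2}"
proof -
  have adj: "rinner (A x) y = rinner x (hadjoint A y)" for x y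
    by (simp add: rinner_def cinner_hadjoint[OF A])
  have "hadjoint A (c *\<^sub>C y) = c *\<^sub>C hadjoint A y" for c y
    by (rule rinner_ext)
      (simp add: rinner_def cinner_hadjoint[OF A, symmetric] cinner_scaleC_right)
  hence "complex_linear (hadjoint A o\<^sub>L A)" using A by (simp add: complex_linear_def)
  moreover have form: "rinner ((hadjoint A o\<^sub>L A) x) y = rinner (A x) (A y)" for x y
    using adj[of y "A x"] by (simp add: rinner_commute)
  ultimately show pos: "positive_op (hadjoint A o\<^sub>L A)"
    by (auto simp del: blinfun_apply_blinfun_compose
        simp: positive_op_iff self_adjoint_iff_rinner rinner_self)
      (metis form rinner_commute)
  show "op_spectrum (hadjoint A o\<^sub>L A) \<subseteq> complex_of_real ` {0..(norm A)\<^sup>2}"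
  proof (rule positive_op_spectrum[OF pos])
    fix x
    have "(norm (A x))\<^sup>2 \<le> (norm A * norm x)\<^sup>2" by (intro power_mono norm_blinfun norm_ge_zero)
    thus "rinner ((hadjoint A o\<^sub>L A) x) x \<le> (norm A)\<^sup>2 * (norm x)\<^sup>2"
      unfolding form rinner_self power_mult_distrib .
  qed
qed

lemma positive_op_abs:
  assumes "complex_linear A"
  shows "positive_op (op_abs A)"
  unfolding op_abs_def using hadjoint_compose_self[OF assms]
  by (intro positive_op_fun_calc continuous_intros) (auto simp: positive_op_def)

text \<open>This follows from \<open>sqrt r \<le> norm A\<close> on the spectrum of \<open>A\<^sup>* A\<close>.\<close>

lemma norm_op_abs_le:
  assumes "complex_linear A"
  shows "norm (op_abs A) \<le> norm A"
  unfolding op_abs_def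
proof (rule norm_fun_calc_le[OF _ hadjoint_compose_self(2)[OF assms]])
  show "self_adjoint (hadjoint A o\<^sub>L A)"
    using hadjoint_compose_self(1)[OF assms] by (simp add: positive_op_def)
  show "\<bar>sqrt r\<bar> \<le> norm A" if "r \<in> {0..(norm A)\<^sup>2}" for r
    using real_sqrt_le_mono[of r "(norm A)\<^sup>2"] that by simp
qed (auto intro: continuous_intros)

section \<open>Hermite-Hadamard inequalities for midpoint convex functions\<close>

text \<open>At a point where the difference of \<open>g\<close> and its chord is maximal, midpoint convexity towards
  the nearer end point, where the difference is \<open>0\<close>, bounds the maximum by half of itself.\<close>

lemma midpoint_convex_le_chord:
  fixes g :: "real \<Rightarrow> real"
  assumes cont: "continuous_on {0..1} g"
    and mid: "\<And>s t. s \<in> {0..1} \<Longrightarrow> t \<in> {0..1} \<Longrightarrow> g ((s + t) / 2) \<le> (g s + g t) / 2"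
    and t: "t \<in> {0..1}"
  shows "g t \<le> (1 - t) * g 0 + t * g 1"
proof -
  define h where "h s = g s - ((1 - s) * g 0 + s * g 1)" for s
  have "continuous_on {0..1} h" unfolding h_def by (intro continuous_intros cont)
  then obtain m where m: "m \<in> {0..1}" "\<And>s. s \<in> {0..1} \<Longrightarrow> h s \<le> h m"
    using continuous_attains_sup[of "{0..1::real}" h] by auto
  have h01: "h 0 = 0" "h 1 = 0" by (simp_all add: h_def)
  have hmid: "h ((r + s) / 2) \<le> (h r + h s) / 2" if "r \<in> {0..1}" "s \<in> {0..1}" for r s
    using mid[OF that] by (simp add: h_def field_simps)
  have "h m \<le> 0"
  proof (cases "m \<le> 1/2")
    case True
    thus ?thesis using hmid[of 0 "2 * m"] m(2)[of "2 * m"] m(1) h01 by simp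
  next
    case False
    thus ?thesis using hmid[of 1 "2 * m - 1"] m(2)[of "2 * m - 1"] m(1) h01 by simp
  qed
  thus ?thesis using m(2)[OF t] by (simp add: h_def)
qed

text \<open>The integral of \<open>g\<close> is also that of the symmetrisation \<open>(g t + g (1 - t)) / 2\<close>, which is at
  least \<open>g (1/2)\<close> at every \<open>t\<close>.\<close>

lemma midpoint_convex_le_integral:
  fixes g :: "real \<Rightarrow> real"
  assumes cont: "continuous_on {0..1} g"
    and mid: "\<And>s t. s \<in> {0..1} \<Longrightarrow> t \<in> {0..1} \<Longrightarrow> g ((s + t) / 2) \<le> (g s + g t) / 2"
  shows "g (1/2) \<le> integral {0..1} g"
proof -
  have int: "(g has_integral integral {0..1} g) {0..1}"
    by (intro integrable_integral integrable_continuous_real cont)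
  have "((\<lambda>t. g (1 - t)) has_integral integral {0..1} g) {0..1}"
    using has_integral_affinity[of g "integral {0..1} g" 0 1 "-1" 1] int by simp
  from has_integral_mult_left[OF has_integral_add[OF int this], of "1/2"]
  have "((\<lambda>t. (g t + g (1 - t)) * (1/2)) has_integral integral {0..1} g) {0..1}" by simp
  moreover have "((\<lambda>t::real. g (1/2)) has_integral g (1/2)) {0..1}"
    using has_integral_const_real[of "g (1/2)" 0 1] by simp
  moreover have "g (1/2) \<le> (g t + g (1 - t)) * (1/2)" if "t \<in> {0..1}" for t
    using mid[of t "1 - t"] that by simp
  ultimately show ?thesis using has_integral_le by blast
qed

lemma integral_chord: "integral {0..1} (\<lambda>t. (1 - t) * c + t * d) = (c + d) / (2::real)"
proof (rule integral_unique)
  define F where "F t = t * c + t\<^sup>2 / 2 * (d - c)" for t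
  have "(F has_real_derivative (1 - t) * c + t * d) (at t within {0..1})" for t
    unfolding F_def by (rule derivative_eq_intros refl | simp)+ (simp add: algebra_simps)
  hence "((\<lambda>t. (1 - t) * c + t * d) has_integral F 1 - F 0) {0..1}"
    by (intro fundamental_theorem_of_calculus)
      (simp_all flip: has_real_derivative_iff_has_vector_derivative)
  thus "((\<lambda>t. (1 - t) * c + t * d) has_integral (c + d) / 2) {0..1}"
    by (simp add: F_def field_simps)
qed

section \<open>The operator inequality of Hermite-Hadamard type\<close>

theorem proposition2p1:
  fixes A B :: "'a::complex_hilbert \<Rightarrow>\<^sub>L 'a"
    and f :: "real \<Rightarrow> real"
  assumes "complex_linear A" and "complex_linear B"
    and "\<And>x. 0 \<le> x \<Longrightarrow> 0 \<le> f x"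
    and "mono_on {0..} f"
    and "operator_convex_on TYPE('a) {0..} f"
  shows "norm (fun_calc f ((1/4) *\<^sub>R (op_abs A + op_abs B)))
           \<le> norm (integral {0..1}
               (\<lambda>t::real. fun_calc f ((1/2) *\<^sub>R ((1 - t) *\<^sub>R op_abs A + t *\<^sub>R op_abs B)))) \<and>
         norm (integral {0..1}
               (\<lambda>t::real. fun_calc f ((1/2) *\<^sub>R ((1 - t) *\<^sub>R op_abs A + t *\<^sub>R op_abs B))))
           \<le> 1/2 * f (1/2 * norm A) + 1/2 * f (1/2 * norm B)"
proof -
  define X where "X t = (1/2) *\<^sub>R ((1 - t) *\<^sub>R op_abs A + t *\<^sub>R op_abs B)" for t :: real
  define G where "G t = fun_calc f (X t)" for t
  have cont_f: "continuous_on {0..} f"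
    and convex: "\<And>X Y :: 'a \<Rightarrow>\<^sub>L 'a. self_adjoint X \<Longrightarrow> self_adjoint Y \<Longrightarrow>
      op_spectrum X \<subseteq> complex_of_real ` {0..} \<Longrightarrow> op_spectrum Y \<subseteq> complex_of_real ` {0..} \<Longrightarrow>
      op_le (fun_calc f ((1/2) *\<^sub>R (X + Y))) ((1/2) *\<^sub>R (fun_calc f X + fun_calc f Y))"
    using assms(5) by (simp_all add: operator_convex_on_def)
  have f: "continuous_on {0..b} f" for b by (rule continuous_on_subset[OF cont_f]) auto
  have positive_scaleR: "positive_op (r *\<^sub>R S)" if "0 \<le> r" "positive_op S"
    for r and S :: "'a \<Rightarrow>\<^sub>L 'a"
    using that by (simp add: positive_op_iff self_adjoint_scaleR blinfun.scaleR_left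
        rinner_scaleR_left)
  have positive_add: "positive_op (S + T)" if "positive_op S" "positive_op T"
    for S T :: "'a \<Rightarrow>\<^sub>L 'a"
    using that by (simp add: positive_op_iff self_adjoint_add blinfun.add_left rinner_add_left)
  have posX: "positive_op (X t)" if "t \<in> {0..1}" for t
    unfolding X_def using that
    by (intro positive_scaleR positive_add positive_op_abs assms(1,2)) auto
  hence selfX: "self_adjoint (X t)" if "t \<in> {0..1}" for t
    using that by (simp add: positive_op_def)
  have spX: "op_spectrum (X t) \<subseteq> complex_of_real ` {0..norm (X t)}" if "t \<in> {0..1}" for t
    by (intro positive_op_spectrum posX that rinner_blinfun_le)
  define b where "b = norm A + norm B"
  have normX: "norm (X t) \<le> b" if "t \<in> {0..1}" for t
  proof -
    have "norm (X t) \<le> (1/2) * ((1 - t) * norm (op_abs A) + t * norm (op_abs B))"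
      using norm_triangle_ineq[of "(1 - t) *\<^sub>R op_abs A" "t *\<^sub>R op_abs B"] that
      by (simp add: X_def)
    also have "\<dots> \<le> (1/2) * (1 * norm A + 1 * norm B)"
      using that norm_op_abs_le[OF assms(1)] norm_op_abs_le[OF assms(2)]
      by (intro mult_left_mono add_mono mult_mono) auto
    also have "\<dots> \<le> b" by (simp add: b_def)
    finally show ?thesis .
  qed
  have spXb: "op_spectrum (X t) \<subseteq> complex_of_real ` {0..b}" if "t \<in> {0..1}" for t
    using normX[OF that] by (intro order_trans[OF spX[OF that]] image_mono) simp
  have posG: "positive_op (G t)" if "t \<in> {0..1}" for t
    unfolding G_def using assms(3) by (intro positive_op_fun_calc[OF selfX spXb f] that) auto
  have contG: "continuous_on {0..1} G"
    unfolding G_def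
    by (rule continuous_on_fun_calc[OF _ selfX spXb f]) (auto simp: X_def intro!: continuous_intros)
  have midG: "op_le (G ((s + t) / 2)) ((1/2) *\<^sub>R (G s + G t))"
    if "s \<in> {0..1}" "t \<in> {0..1}" for s t
  proof -
    define D where "D = (1/2) *\<^sub>R (op_abs B - op_abs A)"
    have affine: "X r = X 0 + r *\<^sub>R D" for r
      by (simp add: X_def D_def scaleR_diff_left scaleR_diff_right scaleR_add_right)
    have "X s + X t = (X 0 + X 0) + (s + t) *\<^sub>R D"
      unfolding affine[of s] affine[of t] by (simp add: scaleR_add_left)
    hence "X ((s + t) / 2) = (1/2) *\<^sub>R (X s + X t)"
      unfolding affine[of "(s + t) / 2"]
      by (simp add: scaleR_add_right[of _ "X 0 + X 0"] scaleR_half_double)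
    moreover have "op_spectrum (X r) \<subseteq> complex_of_real ` {0..}" if "r \<in> {0..1}" for r
      by (intro order_trans[OF spX[OF that]] image_mono) auto
    ultimately show ?thesis using convex[OF selfX selfX] that by (simp add: G_def)
  qed
  have intG: "G integrable_on {0..1}" by (rule integrable_continuous_real[OF contG])
  have "norm (G (1/2)) \<le> norm (integral {0..1} G)"
  proof (rule norm_positive_op_le)
    show "positive_op (G (1/2))" by (rule posG) simp
    fix x
    define q where "q S = rinner (blinfun_apply S x) x" for S :: "'a \<Rightarrow>\<^sub>L 'a"
    have q: "bounded_linear q"
      unfolding q_def
      by (rule bounded_linear_compose[OF rinner.bounded_linear_left blinfun.bounded_linear_left])
    have "q (G (1/2)) \<le> integral {0..1} (\<lambda>t. q (G t))"
    proof (rule midpoint_convex_le_integral)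
      show "continuous_on {0..1} (\<lambda>t. q (G t))"
        by (rule bounded_linear.continuous_on[OF q contG])
      show "q (G ((s + t) / 2)) \<le> (q (G s) + q (G t)) / 2" if "s \<in> {0..1}" "t \<in> {0..1}" for s t
        using op_le_rinner[OF midG[OF that], of x]
        by (simp add: q_def blinfun.bilinear_simps rinner_scaleR_left rinner_add_left)
    qed
    also have "\<dots> = q (integral {0..1} G)" using integral_linear[OF intG q] by (simp add: o_def)
    also have "\<dots> \<le> norm (integral {0..1} G) * (norm x)\<^sup>2"
      unfolding q_def by (rule rinner_blinfun_le)
    finally show "rinner (G (1/2) x) x \<le> norm (integral {0..1} G) * (norm x)\<^sup>2"
      by (simp add: q_def)
  qed simp
  moreover have "norm (integral {0..1} G) \<le> 1/2 * f (1/2 * norm A) + 1/2 * f (1/2 * norm B)"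
  proof -
    have "norm (integral {0..1} G) \<le> integral {0..1} (\<lambda>t. (1 - t) * norm (G 0) + t * norm (G 1))"
    proof (rule integral_norm_bound_integral[OF intG])
      show "(\<lambda>t. (1 - t) * norm (G 0) + t * norm (G 1)) integrable_on {0..1}"
        by (intro integrable_continuous_real continuous_intros)
      fix t :: real assume "t \<in> {0..1}"
      thus "norm (G t) \<le> (1 - t) * norm (G 0) + t * norm (G 1)"
      proof (rule midpoint_convex_le_chord[of "\<lambda>t. norm (G t)", rotated 2])
        show "continuous_on {0..1} (\<lambda>t. norm (G t))" by (intro continuous_intros contG)
        fix s t :: real assume st: "s \<in> {0..1}" "t \<in> {0..1}"
        hence "norm (G ((s + t) / 2)) \<le> norm ((1/2) *\<^sub>R (G s + G t))"
          by (intro norm_mono_op_le posG midG) auto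
        also have "\<dots> \<le> (norm (G s) + norm (G t)) / 2"
          using norm_triangle_ineq[of "G s" "G t"] by simp
        finally show "norm (G ((s + t) / 2)) \<le> (norm (G s) + norm (G t)) / 2" .
      qed
    qed
    also have "\<dots> = (norm (G 0) + norm (G 1)) / 2" by (rule integral_chord)
    finally have chord: "norm (integral {0..1} G) \<le> (norm (G 0) + norm (G 1)) / 2" .
    have ends: "norm (G t) \<le> f (1/2 * c)" if t: "t \<in> {0..1}" and c: "norm (X t) \<le> 1/2 * c" for t c
      unfolding G_def
    proof (rule norm_fun_calc_le[OF selfX[OF t] _ f])
      show "op_spectrum (X t) \<subseteq> complex_of_real ` {0..1/2 * c}"
        using c by (intro order_trans[OF spX[OF t]] image_mono) simp
      have "0 \<le> 1/2 * c" using c norm_ge_zero order_trans by blast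
      thus "0 \<le> f (1/2 * c)" by (rule assms(3))
      show "\<bar>f r\<bar> \<le> f (1/2 * c)" if "r \<in> {0..1/2 * c}" for r
        using that assms(3)[of r] monotone_onD[OF assms(4), of r "1/2 * c"] by simp
    qed
    have "norm (G 0) \<le> f (1/2 * norm A)" "norm (G 1) \<le> f (1/2 * norm B)"
      by (rule ends; use norm_op_abs_le[OF assms(1)] norm_op_abs_le[OF assms(2)] in
          \<open>simp add: X_def\<close>)+
    with chord show ?thesis by argo
  qed
  moreover have "X (1/2) = (1/4) *\<^sub>R (op_abs A + op_abs B)"
    by (simp add: X_def scaleR_add_right)
  ultimately show ?thesis unfolding G_def X_def by simp
qed

end
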